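(* Let $S$ be a pseudocompact Tychonoff right topological monoid with identity $1$, let $X$ be a pseudocompact Tychonoff space, and let $\pi : S \times X \to X$ be an action of $S$ on $X$ which is separately continuous and quasicontinuous and satisfies $\pi(1,x)=x$ for each $x \in X$. Then $\pi$ is (jointly) continuous at each point of $\{1\}\times X$.
   Context: A space is pseudocompact if every real-valued continuous function on it is bounded. A right topological monoid is a semigroup $S$ with an identity, endowed with a topology, such that for each $x\in S$ the map $s_x : S \to S$, $s_x(y)=xy$, is continuous. An action of a semigroup $S$ on a set $X$ is a map $\pi : S\times X\to X$ with $\pi(s_1s_2,x)=\pi(s_1,\pi(s_2,x))$ for all $s_1,s_2\in S$, $x\in X$. A map $f : X\times Y\to Z$ is separately continuous if $y\mapsto f(x,y)$ is continuous for each fixed $x$ and $x\mapsto f(x,y)$ is continuous for each fixed $y$. A function $f : A\to B$ between topological spaces is quasicontinuous if for every $a\in A$, every open $V\subset B$ with $f(a)\in V$ and every open $U\subset A$ with $a\in U$ there is a nonempty open $W\subset U$ with $f(W)\subset V$; for $\pi$ this refers to the product topology on $S\times X$. *)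

theory Defs
  imports "HOL-Analysis.Analysis" "HOL-Algebra.Group"
begin

definition pseudocompact_space :: "'a topology \<Rightarrow> bool" where
  "pseudocompact_space X \<longleftrightarrow>
     (\<forall>f. continuous_map X euclideanreal f \<longrightarrow> bounded (f ` topspace X))"

(* The library's completely_regular_space carries no separation axiom of its own. *)
definition tychonoff_space :: "'a topology \<Rightarrow> bool" where
  "tychonoff_space X \<longleftrightarrow> completely_regular_space X \<and> Hausdorff_space X"

(* Convention: "right topological" means that y \<mapsto> x y is continuous for each fixed x;
   part of the literature calls this "left topological". *)
definition right_topological_monoid :: "('a, 'm) monoid_scheme \<Rightarrow> 'a topology \<Rightarrow> bool" where
  "right_topological_monoid S T \<longleftrightarrow>
     Group.monoid S \<and> topspace T = carrier S \<and>
     (\<forall>x \<in> carrier S. continuous_map T T (\<lambda>y. x \<otimes>\<^bsub>S\<^esub> y))"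

definition semigroup_action :: "('a, 'm) monoid_scheme \<Rightarrow> 'b set \<Rightarrow> ('a \<times> 'b \<Rightarrow> 'b) \<Rightarrow> bool" where
  "semigroup_action S E p \<longleftrightarrow>
     p \<in> carrier S \<times> E \<rightarrow> E \<and>
     (\<forall>s1 \<in> carrier S. \<forall>s2 \<in> carrier S. \<forall>x \<in> E. p (s1 \<otimes>\<^bsub>S\<^esub> s2, x) = p (s1, p (s2, x)))"

definition separately_continuous_map ::
    "'a topology \<Rightarrow> 'b topology \<Rightarrow> 'c topology \<Rightarrow> ('a \<times> 'b \<Rightarrow> 'c) \<Rightarrow> bool" where
  "separately_continuous_map X Y Z f \<longleftrightarrow>
     (\<forall>x \<in> topspace X. continuous_map Y Z (\<lambda>y. f (x, y))) \<and>
     (\<forall>y \<in> topspace Y. continuous_map X Z (\<lambda>x. f (x, y)))"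

definition quasicontinuous_map :: "'a topology \<Rightarrow> 'b topology \<Rightarrow> ('a \<Rightarrow> 'b) \<Rightarrow> bool" where
  "quasicontinuous_map A B f \<longleftrightarrow>
     f \<in> topspace A \<rightarrow> topspace B \<and>
     (\<forall>a \<in> topspace A. \<forall>V U. openin B V \<and> f a \<in> V \<and> openin A U \<and> a \<in> U \<longrightarrow>
        (\<exists>W. openin A W \<and> W \<noteq> {} \<and> W \<subseteq> U \<and> f ` W \<subseteq> V))"

end

theory Submission
  imports Defs
begin

text \<open>
  Fix \<open>f\<close> with \<open>f x\<^sub>0 = 0\<close> and suppose that \<open>f (s x) = 1\<close> for points \<open>(s, x)\<close> arbitrarily close to
  \<open>(1, x\<^sub>0)\<close>; put \<open>\<Phi> (t, y) = f (t y)\<close>. Quasicontinuity yields, near any \<open>t\<close>, open sets \<open>T\<close>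
  and neighbourhoods \<open>W\<close> of \<open>x\<^sub>0\<close> on which \<open>\<Phi>\<close> is almost constant in the second variable, and
  likewise with the roles of the variables exchanged. For \<open>t\<close> in such a \<open>T\<close> close to \<open>1\<close>, the
  identity \<open>\<Phi> (t, s x) = \<Phi> (t s, x)\<close> shows that \<open>\<Phi> (t, s x)\<close> is small when \<open>(s, x)\<close> is close to
  \<open>(1, x\<^sub>0)\<close>, although \<open>\<Phi> (1, s x) = 1\<close> for some of these points. Iterating gives neighbourhoods
  \<open>U\<^sub>i\<close> of \<open>1\<close>, points \<open>t\<^sub>i \<in> U\<^sub>i\<close> and open sets \<open>V\<^sub>j\<close> such that \<open>\<Phi>\<close> is large on \<open>U\<^sub>i \<times> V\<^sub>j\<close> for
  \<open>j \<le> i\<close> and small on \<open>{t\<^sub>i} \<times> V\<^sub>j\<close> for \<open>i < j\<close>. Pseudocompactness forbids such a double sequence, because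
  sequences of nonempty open sets have cluster points.
\<close>

section \<open>Pseudocompactness through sequences of open sets\<close>

text \<open>That is, no sequence of nonempty open sets is locally finite. Indices are counted rather
  than sets, so repetitions are harmless.\<close>

definition feebly_compact_space :: "'a topology \<Rightarrow> bool" where
  "feebly_compact_space X \<longleftrightarrow>
     (\<forall>U :: nat \<Rightarrow> 'a set. (\<forall>n. openin X (U n) \<and> U n \<noteq> {}) \<longrightarrow>
        (\<exists>x \<in> topspace X. \<forall>W. openin X W \<and> x \<in> W \<longrightarrow> infinite {n. U n \<inter> W \<noteq> {}}))"

text \<open>Over a locally finite sequence of nonempty open sets one can sum bumps of height
  \<open>n\<close> vanishing off \<open>U n\<close>; the sum is continuous but unbounded.\<close>

lemma pseudocompact_imp_feebly_compact_space:
  assumes pc: "pseudocompact_space X" and cr: "completely_regular_space X"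
  shows "feebly_compact_space X"
  unfolding feebly_compact_space_def
proof (intro allI impI, rule ccontr)
  fix U :: "nat \<Rightarrow> 'a set"
  assume U: "\<forall>n. openin X (U n) \<and> U n \<noteq> {}"
    and "\<not> (\<exists>x\<in>topspace X. \<forall>W. openin X W \<and> x \<in> W \<longrightarrow> infinite {n. U n \<inter> W \<noteq> {}})"
  then obtain W where W: "\<And>x. x \<in> topspace X \<Longrightarrow> openin X (W x) \<and> x \<in> W x \<and> finite {n. U n \<inter> W x \<noteq> {}}"
    by metis
  have "\<exists>x g. x \<in> U n \<and> continuous_map X euclideanreal g \<and> g x = real n \<and>
      (\<forall>z \<in> topspace X. 0 \<le> g z) \<and> (\<forall>z \<in> topspace X - U n. g z = 0)" for n
  proof -
    obtain x where x: "x \<in> U n" using U by blast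
    have "closedin X (topspace X - U n)" "x \<in> topspace X - (topspace X - U n)"
      using U x openin_subset by (blast, fastforce)
    then obtain h where h: "continuous_map X (top_of_set {0..1::real}) h" "h x = 0" "h ` (topspace X - U n) \<subseteq> {1}"
      using cr unfolding completely_regular_space_def by metis
    have hc: "continuous_map X euclideanreal h" and h01: "h \<in> topspace X \<rightarrow> {0..1}"
      using h(1) by (auto simp: continuous_map_in_subtopology)
    \<comment> \<open>\<open>h\<close> is 0 at \<open>x\<close> and 1 off \<open>U n\<close>, so it
      is flipped before scaling.\<close>
    have "continuous_map X euclideanreal (\<lambda>z. real n * (1 - h z))"
      by (intro continuous_intros hc)
    moreover have "\<forall>z\<in>topspace X. 0 \<le> real n * (1 - h z)" using h01 by (force simp: Pi_iff)
    moreover have "\<forall>z\<in>topspace X - U n. real n * (1 - h z) = 0" using h(3) by auto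
    ultimately show ?thesis using x h(2) by (intro exI[of _ x] exI[of _ "\<lambda>z. real n * (1 - h z)"]) auto
  qed
  then obtain x g where xU: "\<And>n. x n \<in> U n" and gc: "\<And>n. continuous_map X euclideanreal (g n)"
    and gx: "\<And>n. g n (x n) = real n" and g0: "\<And>n z. z \<in> topspace X \<Longrightarrow> 0 \<le> g n z"
    and gz: "\<And>n z. z \<in> topspace X - U n \<Longrightarrow> g n z = 0"
    by metis
  define F where "F z = (\<Sum>n | z \<in> U n. g n z)" for z
  have UX: "U n \<subseteq> topspace X" for n using U openin_subset by blast
  have fin: "finite {n. z \<in> U n}" if "z \<in> topspace X" for z
    by (rule finite_subset[of _ "{n. U n \<inter> W z \<noteq> {}}"]) (use W[OF that] in auto)
  \<comment> \<open>On \<open>W y\<close> the index set no longer depends on \<open>z\<close>: the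
    added terms vanish. So \<open>F\<close> is locally a finite sum of continuous functions.\<close>
  have F_local: "F z = (\<Sum>n | U n \<inter> W y \<noteq> {}. g n z)" if "y \<in> topspace X" "z \<in> topspace X" "z \<in> W y" for y z
    unfolding F_def using W[OF that(1)] that gz by (intro sum.mono_neutral_left) auto
  have "continuous_map X euclideanreal F"
  proof (rule pasting_lemma[where I = "topspace X" and T = W and f = "\<lambda>y z. \<Sum>n | U n \<inter> W y \<noteq> {}. g n z"])
    fix y assume y: "y \<in> topspace X"
    show "openin X (W y)" using W[OF y] by blast
    show "continuous_map (subtopology X (W y)) euclideanreal (\<lambda>z. \<Sum>n | U n \<inter> W y \<noteq> {}. g n z)"
      using W[OF y] by (intro continuous_map_from_subtopology continuous_map_sum gc) auto
  next
    fix i j z assume "i \<in> topspace X" "j \<in> topspace X" "z \<in> topspace X \<inter> W i \<inter> W j"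
    then show "(\<Sum>n | U n \<inter> W i \<noteq> {}. g n z) = (\<Sum>n | U n \<inter> W j \<noteq> {}. g n z)"
      using F_local by (metis IntD1 IntD2)
  next
    fix z assume "z \<in> topspace X"
    then show "\<exists>j. j \<in> topspace X \<and> z \<in> W j \<and> F z = (\<Sum>n | U n \<inter> W j \<noteq> {}. g n z)"
      using F_local W by blast
  qed
  then obtain B where B: "\<And>z. z \<in> topspace X \<Longrightarrow> \<bar>F z\<bar> \<le> B"
    using pc unfolding pseudocompact_space_def bounded_iff by (metis image_eqI real_norm_def)
  obtain n where n: "real n > B" using reals_Archimedean2 by blast
  have xX: "x n \<in> topspace X" using xU UX by blast
  have "real n = g n (x n)" by (simp add: gx)
  also have "\<dots> \<le> F (x n)"
    unfolding F_def using fin[OF xX] xU g0[OF xX]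
    by (intro member_le_sum[where f = "\<lambda>k. g k (x n)"]) auto
  finally show False using B[OF xX] n by linarith
qed

section \<open>Cluster points and double sequences\<close>

lemma openin_less: "continuous_map X euclideanreal g \<Longrightarrow> openin X {x \<in> topspace X. g x < c}"
  and openin_greater: "continuous_map X euclideanreal g \<Longrightarrow> openin X {x \<in> topspace X. g x > c}"
  using openin_continuous_map_preimage[of X euclideanreal g "{..<c}"]
    openin_continuous_map_preimage[of X euclideanreal g "{c<..}"] by auto

text \<open>Otherwise \<open>g < c\<close> would define a neighbourhood of \<open>x\<close> meeting
  \<open>U n\<close> only for \<open>n < m\<close>.\<close>

lemma cluster_point_ge:
  fixes U :: "nat \<Rightarrow> 'a set"
  assumes x: "x \<in> topspace X" and cl: "\<forall>W. openin X W \<and> x \<in> W \<longrightarrow> infinite {n. U n \<inter> W \<noteq> {}}"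
    and g: "continuous_map X euclideanreal g"
    and ge: "\<And>n z. m \<le> n \<Longrightarrow> z \<in> U n \<Longrightarrow> c \<le> g z"
  shows "c \<le> g x"
proof (rule ccontr)
  assume "\<not> c \<le> g x"
  then have "infinite {n. U n \<inter> {z \<in> topspace X. g z < c} \<noteq> {}}"
    using cl openin_less[OF g] x by auto
  moreover have "{n. U n \<inter> {z \<in> topspace X. g z < c} \<noteq> {}} \<subseteq> {..<m}"
    using ge by (force simp: not_less[symmetric])
  ultimately show False using finite_subset by blast
qed

lemma cluster_point_le:
  fixes U :: "nat \<Rightarrow> 'a set"
  assumes "x \<in> topspace X" and "\<forall>W. openin X W \<and> x \<in> W \<longrightarrow> infinite {n. U n \<inter> W \<noteq> {}}"
    and g: "continuous_map X euclideanreal g"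
    and le: "\<And>n z. m \<le> n \<Longrightarrow> z \<in> U n \<Longrightarrow> g z \<le> c"
  shows "g x \<le> c"
  using cluster_point_ge[where g = "\<lambda>z. - g z" and c = "- c" and m = m, OF assms(1,2)] le
  by (simp add: continuous_map_minus g)

text \<open>The two iterated limits disagree. A cluster point \<open>y\<close> of the
  \<open>V j\<close> inherits \<open>\<Phi> (t i) y \<le> a\<close>; the \<open>U i\<close> can then
  be cut down around \<open>t i\<close> to where \<open>\<Phi> x y\<close> stays below a level under
  \<open>b\<close>, and a cluster point of these smaller sets contradicts the lower bound.\<close>

lemma no_double_sequence:
  fixes \<Phi> :: "'a \<Rightarrow> 'b \<Rightarrow> real" and U :: "nat \<Rightarrow> 'a set" and V :: "nat \<Rightarrow> 'b set"
  assumes fX: "feebly_compact_space X" and fY: "feebly_compact_space Y"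
    and c1: "\<And>y. y \<in> topspace Y \<Longrightarrow> continuous_map X euclideanreal (\<lambda>x. \<Phi> x y)"
    and c2: "\<And>x. x \<in> topspace X \<Longrightarrow> continuous_map Y euclideanreal (\<Phi> x)"
    and U: "\<And>n. openin X (U n)"
    and V: "\<And>n. openin Y (V n)" "\<And>n. V n \<noteq> {}"
    and t: "\<And>n. t n \<in> U n"
    and le: "\<And>i j y. i < j \<Longrightarrow> y \<in> V j \<Longrightarrow> \<Phi> (t i) y \<le> a"
    and ge: "\<And>i j x y. j \<le> i \<Longrightarrow> x \<in> U i \<Longrightarrow> y \<in> V j \<Longrightarrow> b \<le> \<Phi> x y"
    and "a < b"
  shows False
proof -
  obtain y where y: "y \<in> topspace Y" and ycl: "\<forall>W. openin Y W \<and> y \<in> W \<longrightarrow> infinite {n. V n \<inter> W \<noteq> {}}"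
    using fY V unfolding feebly_compact_space_def by metis
  have tX: "t i \<in> topspace X" for i using U t openin_subset by blast
  have ty: "\<Phi> (t i) y \<le> a" for i
    by (rule cluster_point_le[OF y ycl c2[OF tX], where m = "Suc i"]) (auto simp: le Suc_le_eq)
  \<comment> \<open>The midpoint leaves room on both sides: the strict bound \<open>< d\<close>
    keeps \<open>U' i\<close> open, \<open>a < d\<close> keeps \<open>t i\<close> inside, and
    \<open>d < b\<close> gives the contradiction.\<close>
  define d where "d = (a + b) / 2"
  define U' where "U' i = U i \<inter> {x \<in> topspace X. \<Phi> x y < d}" for i
  have "openin X (U' i)" for i
    unfolding U'_def by (intro openin_Int U openin_less c1 y)
  moreover have "t i \<in> U' i" for i
    using ty[of i] t tX \<open>a < b\<close> by (auto simp: U'_def d_def)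
  ultimately obtain x where x: "x \<in> topspace X"
    and xcl: "\<forall>W. openin X W \<and> x \<in> W \<longrightarrow> infinite {n. U' n \<inter> W \<noteq> {}}"
    using fX unfolding feebly_compact_space_def by (metis empty_iff)
  have VY: "V j \<subseteq> topspace Y" for j using V openin_subset by blast
  have "\<Phi> x y \<le> d"
    by (rule cluster_point_le[OF x xcl c1[OF y], where m = 0]) (auto simp: U'_def)
  moreover have "b \<le> \<Phi> x y"
  \<comment> \<open>For fixed \<open>v\<close> in \<open>V j\<close> the bound passes to
    \<open>x\<close>, using only indices from \<open>j\<close> on; afterwards it passes to
    \<open>y\<close>.\<close>
  proof (rule cluster_point_ge[OF y ycl c2[OF x], where m = 0])
    fix j v assume v: "v \<in> V j"
    then show "b \<le> \<Phi> x v"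
      using VY ge by (intro cluster_point_ge[OF x xcl c1, where m = j]) (auto simp: U'_def)
  qed
  ultimately show False using \<open>a < b\<close> by (auto simp: d_def)
qed

text \<open>Packages the dependent choice. \<open>W\<close> confines all later sets
  \<open>V\<close>, so once \<open>\<Phi> t\<close> is small on \<open>W'\<close> it is small on
  every later \<open>V\<close>; \<open>U\<close> only shrinks, so lower bounds on
  \<open>U' \<times> V\<close> persist.\<close>

lemma no_refinement_strategy:
  fixes \<Phi> :: "'a \<Rightarrow> 'b \<Rightarrow> real" and P :: "'a set \<Rightarrow> 'b set \<Rightarrow> bool"
  assumes fX: "feebly_compact_space X" and fY: "feebly_compact_space Y"
    and c1: "\<And>y. y \<in> topspace Y \<Longrightarrow> continuous_map X euclideanreal (\<lambda>x. \<Phi> x y)"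
    and c2: "\<And>x. x \<in> topspace X \<Longrightarrow> continuous_map Y euclideanreal (\<Phi> x)"
    and init: "P U0 W0" and P: "\<And>U W. P U W \<Longrightarrow> openin X U"
    and refine: "\<And>U W. P U W \<Longrightarrow> \<exists>U' W' V t. P U' W' \<and> U' \<subseteq> U \<and> W' \<subseteq> W \<and> V \<subseteq> W \<and>
        openin Y V \<and> V \<noteq> {} \<and> (\<forall>x\<in>U'. \<forall>y\<in>V. b \<le> \<Phi> x y) \<and> t \<in> U' \<and> (\<forall>y\<in>W'. \<Phi> t y \<le> a)"
    and "a < b"
  shows False
proof -
  define R where "R = (\<lambda>(U, W) (U', W', V, t). P U' W' \<and> U' \<subseteq> U \<and> W' \<subseteq> W \<and> V \<subseteq> W \<and>
        openin Y V \<and> V \<noteq> {} \<and> (\<forall>x\<in>U'. \<forall>y\<in>V. b \<le> \<Phi> x y) \<and> t \<in> U' \<and> (\<forall>y\<in>W'. \<Phi> t y \<le> a))"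
  have R: "\<exists>q. R (U, W) q" if "P U W" for U W
    using refine[OF that] unfolding R_def by auto
  have "\<exists>s. \<forall>n. (case s n of (U, W, V, t) \<Rightarrow> P U W \<and> openin Y V \<and> V \<noteq> {} \<and>
        (\<forall>x\<in>U. \<forall>y\<in>V. b \<le> \<Phi> x y) \<and> t \<in> U \<and> (\<forall>y\<in>W. \<Phi> t y \<le> a)) \<and>
      (case s n of (U, W, _) \<Rightarrow> R (U, W) (s (Suc n)))"
  proof (rule dependent_nat_choice, goal_cases)
    case 1
    obtain q where "R (U0, W0) q" using R[OF init] by blast
    \<comment> \<open>The sequence starts with a successor of \<open>(U0, W0)\<close>, so that
      \<open>V\<close> and \<open>t\<close> are present from index 0.\<close>
    then show ?case by (intro exI[of _ q]) (auto simp: R_def split: prod.splits)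
  next
    case (2 s n)
    then obtain U W V t where s: "s = (U, W, V, t)" "P U W" by (auto split: prod.splits)
    obtain q where "R (U, W) q" using R[OF s(2)] by blast
    then show ?case by (intro exI[of _ q]) (auto simp: R_def s split: prod.splits)
  qed
  then obtain s where s: "\<And>n. (case s n of (U, W, V, t) \<Rightarrow> P U W \<and> openin Y V \<and> V \<noteq> {} \<and>
        (\<forall>x\<in>U. \<forall>y\<in>V. b \<le> \<Phi> x y) \<and> t \<in> U \<and> (\<forall>y\<in>W. \<Phi> t y \<le> a)) \<and>
      (case s n of (U, W, _) \<Rightarrow> R (U, W) (s (Suc n)))" by blast
  define U where "U n = fst (s n)" for n
  define W where "W n = fst (snd (s n))" for n
  define V where "V n = fst (snd (snd (s n)))" for n
  define t where "t n = snd (snd (snd (s n)))" for n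
  have sn: "s n = (U n, W n, V n, t n)" for n by (simp add: U_def W_def V_def t_def)
  have inv: "P (U n) (W n)" "openin Y (V n)" "V n \<noteq> {}" "\<And>x y. x \<in> U n \<Longrightarrow> y \<in> V n \<Longrightarrow> b \<le> \<Phi> x y"
    "t n \<in> U n" "\<And>y. y \<in> W n \<Longrightarrow> \<Phi> (t n) y \<le> a"
    and step: "U (Suc n) \<subseteq> U n" "W (Suc n) \<subseteq> W n" "V (Suc n) \<subseteq> W n" for n
    using s[of n] unfolding sn R_def by auto
  have U_anti: "U j \<subseteq> U i" and W_anti: "W j \<subseteq> W i" if "i \<le> j" for i j
    using lift_Suc_antimono_le[of U, OF _ that] lift_Suc_antimono_le[of W, OF _ that] step by auto
  \<comment> \<open>\<open>V j\<close> was chosen inside the previous \<open>W (j - 1)\<close>,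
    hence the strict inequality.\<close>
  have VW: "V j \<subseteq> W i" if "i < j" for i j
    using step(3)[of "j - 1"] W_anti[of i "j - 1"] that by (cases j) auto
  show False
  proof (rule no_double_sequence[OF fX fY c1 c2 P[OF inv(1)] inv(2,3,5) _ _ \<open>a < b\<close>])
    show "\<Phi> (t i) y \<le> a" if "i < j" "y \<in> V j" for i j y
      using VW[OF that(1)] that(2) inv(6) by blast
    show "b \<le> \<Phi> x y" if "j \<le> i" "x \<in> U i" "y \<in> V j" for i j x y
      using U_anti[OF that(1)] that inv(4) by blast
  qed
qed

section \<open>One-sided control from quasicontinuity\<close>

text \<open>If every such rectangle had a point with \<open>\<Phi> \<ge> d\<close>, quasicontinuity
  would spread it to a smaller rectangle with \<open>\<Phi> > b\<close>, while any \<open>t\<close>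
  there has \<open>\<Phi> t < c\<close> near \<open>y0\<close>. Repeating this is a forbidden
  refinement strategy.\<close>

lemma quasicontinuous_locally_less:
  fixes \<Phi> :: "'a \<Rightarrow> 'b \<Rightarrow> real"
  assumes fX: "feebly_compact_space X" and fY: "feebly_compact_space Y"
    and c1: "\<And>y. y \<in> topspace Y \<Longrightarrow> continuous_map X euclideanreal (\<lambda>x. \<Phi> x y)"
    and c2: "\<And>x. x \<in> topspace X \<Longrightarrow> continuous_map Y euclideanreal (\<Phi> x)"
    and qc: "\<And>U V x y c. openin X U \<Longrightarrow> openin Y V \<Longrightarrow> x \<in> U \<Longrightarrow> y \<in> V \<Longrightarrow> c < \<Phi> x y \<Longrightarrow>
      \<exists>U' V'. openin X U' \<and> openin Y V' \<and> U' \<noteq> {} \<and> V' \<noteq> {} \<and> U' \<subseteq> U \<and> V' \<subseteq> V \<and> (\<forall>u\<in>U'. \<forall>v\<in>V'. c < \<Phi> u v)"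
    and U0: "openin X U0" "U0 \<noteq> {}" and y0: "y0 \<in> topspace Y"
    and less: "\<And>x. x \<in> U0 \<Longrightarrow> \<Phi> x y0 < c" and "c < d"
  shows "\<exists>U V. openin X U \<and> U \<noteq> {} \<and> U \<subseteq> U0 \<and> openin Y V \<and> y0 \<in> V \<and> (\<forall>x\<in>U. \<forall>y\<in>V. \<Phi> x y < d)"
proof (rule ccontr)
  assume neg: "\<not> ?thesis"
  define b where "b = (c + d) / 2"
  have b: "c < b" "b < d" using \<open>c < d\<close> by (auto simp: b_def)
  define P where "P U W \<longleftrightarrow> openin X U \<and> U \<noteq> {} \<and> U \<subseteq> U0 \<and> openin Y W \<and> y0 \<in> W" for U W
  show False
  proof (rule no_refinement_strategy[OF fX fY c1 c2, of P U0 "topspace Y" b c])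
    show "P U0 (topspace Y)" using U0 y0 by (auto simp: P_def)
    show "openin X U" if "P U W" for U W using that by (simp add: P_def)
    show "c < b" by (fact b)
    fix U W assume PUW: "P U W"
    then obtain x y where xy: "x \<in> U" "y \<in> W" "d \<le> \<Phi> x y"
      using neg unfolding P_def by (meson not_less)
    then obtain U' V where U': "openin X U'" "openin Y V" "U' \<noteq> {}" "V \<noteq> {}" "U' \<subseteq> U" "V \<subseteq> W"
      "\<forall>u\<in>U'. \<forall>v\<in>V. b < \<Phi> u v"
      using qc[of U W x y b] PUW b by (auto simp: P_def)
    obtain t where t: "t \<in> U'" using U' by blast
    have tU0: "t \<in> U0" using t U' PUW by (auto simp: P_def)
    then have tX: "t \<in> topspace X" using U0 openin_subset by blast
    \<comment> \<open>\<open>W'\<close> still contains \<open>y0\<close>, since \<open>t\<close>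
      lies in \<open>U0\<close>; so the refinement can continue.\<close>
    define W' where "W' = W \<inter> {y \<in> topspace Y. \<Phi> t y < c}"
    have "P U' W'"
      using PUW U' less[OF tU0] y0 unfolding P_def W'_def
      by (auto intro!: openin_Int openin_less c2 tX)
    then show "\<exists>U' W' V t. P U' W' \<and> U' \<subseteq> U \<and> W' \<subseteq> W \<and> V \<subseteq> W \<and> openin Y V \<and> V \<noteq> {} \<and>
        (\<forall>x\<in>U'. \<forall>y\<in>V. b \<le> \<Phi> x y) \<and> t \<in> U' \<and> (\<forall>y\<in>W'. \<Phi> t y \<le> c)"
      using U' t by (intro exI[of _ U'] exI[of _ W'] exI[of _ V] exI[of _ t]) (auto simp: W'_def less_imp_le)
  qed
qed

lemma quasicontinuous_map_rectangle:
  assumes q: "quasicontinuous_map (prod_topology X Y) Z p"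
    and "openin X U" "openin Y V" "openin Z N" "x \<in> U" "y \<in> V" "p (x, y) \<in> N"
  shows "\<exists>U' V'. openin X U' \<and> openin Y V' \<and> U' \<noteq> {} \<and> V' \<noteq> {} \<and> U' \<subseteq> U \<and> V' \<subseteq> V \<and>
    (\<forall>u\<in>U'. \<forall>v\<in>V'. p (u, v) \<in> N)"
proof -
  have "openin (prod_topology X Y) (U \<times> V)" "(x, y) \<in> U \<times> V"
    using assms by (auto simp: openin_prod_Times_iff)
  moreover from this have "(x, y) \<in> topspace (prod_topology X Y)" using openin_subset by blast
  ultimately obtain W where W: "openin (prod_topology X Y) W" "W \<noteq> {}" "W \<subseteq> U \<times> V" "p ` W \<subseteq> N"
    using q assms(4,7) unfolding quasicontinuous_map_def by meson
  obtain u v where "(u, v) \<in> W" using W(2) by auto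
  then obtain U' V' where "openin X U'" "openin Y V'" "u \<in> U'" "v \<in> V'" "U' \<times> V' \<subseteq> W"
    using W(1) unfolding openin_prod_topology_alt by meson
  then show ?thesis using W(3,4) by (intro exI[of _ U'] exI[of _ V']) blast
qed

section \<open>The action near the identity\<close>

theorem theorem3p1:
  fixes S :: "('a, 'm) monoid_scheme"
    and T :: "'a topology"
    and X :: "'b topology"
    and \<pi> :: "'a \<times> 'b \<Rightarrow> 'b"
  assumes "right_topological_monoid S T"
    and "pseudocompact_space T" and "tychonoff_space T"
    and "pseudocompact_space X" and "tychonoff_space X"
    and "semigroup_action S (topspace X) \<pi>"
    and "separately_continuous_map T X X \<pi>"
    and "quasicontinuous_map (prod_topology T X) X \<pi>"
    and "\<forall>x \<in> topspace X. \<pi> (\<one>\<^bsub>S\<^esub>, x) = x"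
  shows "\<forall>z \<in> {\<one>\<^bsub>S\<^esub>} \<times> topspace X. topcontinuous_at (prod_topology T X) X \<pi> z"
proof (clarify, rule ccontr)
  fix x0 assume x0: "x0 \<in> topspace X" and "\<not> topcontinuous_at (prod_topology T X) X \<pi> (\<one>\<^bsub>S\<^esub>, x0)"
  let ?e = "\<one>\<^bsub>S\<^esub>"
  have mon: "Group.monoid S" and TS: "topspace T = carrier S"
    and tr: "\<And>t. t \<in> topspace T \<Longrightarrow> continuous_map T T (\<lambda>s. t \<otimes>\<^bsub>S\<^esub> s)"
    using assms(1) by (auto simp: right_topological_monoid_def)
  have e: "?e \<in> topspace T" using mon TS monoid.one_closed by metis
  have ran: "\<pi> (s, x) \<in> topspace X" if "s \<in> topspace T" "x \<in> topspace X" for s x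
    using assms(6) that TS by (auto simp: semigroup_action_def)
  have act: "\<pi> (t \<otimes>\<^bsub>S\<^esub> s, x) = \<pi> (t, \<pi> (s, x))"
    if "t \<in> topspace T" "s \<in> topspace T" "x \<in> topspace X" for t s x
    using assms(6) that TS by (auto simp: semigroup_action_def)
  have unit: "\<pi> (?e, x) = x" if "x \<in> topspace X" for x using assms(9) that by blast
  have fT: "feebly_compact_space T" and fX: "feebly_compact_space X" and cr: "completely_regular_space X"
    using assms(2-5) pseudocompact_imp_feebly_compact_space by (auto simp: tychonoff_space_def)
  obtain N where N: "openin X N" "x0 \<in> N"
    and bad: "\<And>G. openin (prod_topology T X) G \<Longrightarrow> (?e, x0) \<in> G \<Longrightarrow> \<exists>z\<in>G. \<pi> z \<notin> N"
    using \<open>\<not> topcontinuous_at _ _ _ _\<close> x0 e ran unit[OF x0] unfolding topcontinuous_at_def by auto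
  have "closedin X (topspace X - N)" "x0 \<in> topspace X - (topspace X - N)" using N x0 by auto
  then obtain f where f: "continuous_map X (top_of_set {0..1::real}) f" "f x0 = 0" "f ` (topspace X - N) \<subseteq> {1}"
    using cr unfolding completely_regular_space_def by metis
  have fc: "continuous_map X euclideanreal f" using f(1) by (simp add: continuous_map_in_subtopology)
  have f1: "\<exists>s\<in>A. \<exists>x\<in>W. f (\<pi> (s, x)) = 1" if A: "openin T A" "?e \<in> A" and W: "openin X W" "x0 \<in> W" for A W
  proof -
    have "openin (prod_topology T X) (A \<times> W)" "(?e, x0) \<in> A \<times> W" using A W by (auto simp: openin_prod_Times_iff)
    then obtain z where z: "z \<in> A \<times> W" "\<pi> z \<notin> N" using bad by blast
    then obtain s x where sx: "z = (s, x)" "s \<in> A" "x \<in> W" by blast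
    moreover have "\<pi> (s, x) \<in> topspace X - N"
      using z sx ran openin_subset[OF A(1)] openin_subset[OF W(1)] by auto
    ultimately show ?thesis using f(3) by blast
  qed
  define \<Phi> where "\<Phi> = (\<lambda>t y. f (\<pi> (t, y)))"
  have c1: "continuous_map T euclideanreal (\<lambda>t. \<Phi> t y)" if "y \<in> topspace X" for y
    using continuous_map_compose[OF _ fc, of T "\<lambda>t. \<pi> (t, y)"] assms(7) that
    by (simp add: separately_continuous_map_def \<Phi>_def o_def)
  have c2: "continuous_map X euclideanreal (\<Phi> t)" if "t \<in> topspace T" for t
    using continuous_map_compose[OF _ fc, of X "\<lambda>y. \<pi> (t, y)"] assms(7) that
    by (simp add: separately_continuous_map_def \<Phi>_def o_def)
  have qc: "\<exists>U' V'. openin T U' \<and> openin X V' \<and> U' \<noteq> {} \<and> V' \<noteq> {} \<and> U' \<subseteq> U \<and> V' \<subseteq> V \<and>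
      (\<forall>u\<in>U'. \<forall>v\<in>V'. \<Phi> u v \<in> D)"
    if "openin T U" "openin X V" "t \<in> U" "y \<in> V" "\<Phi> t y \<in> D" "open D" for U V t y D
  proof -
    have "openin X {z \<in> topspace X. f z \<in> D}"
      using fc that(6) by (auto intro: openin_continuous_map_preimage)
    moreover have "\<pi> (t, y) \<in> {z \<in> topspace X. f z \<in> D}"
      using that ran openin_subset[OF that(1)] openin_subset[OF that(2)] by (auto simp: \<Phi>_def)
    ultimately show ?thesis
      using quasicontinuous_map_rectangle[OF assms(8) that(1,2) _ that(3,4), of "{z \<in> topspace X. f z \<in> D}"]
      unfolding \<Phi>_def by blast
  qed
  have upper: "\<exists>U V. openin T U \<and> U \<noteq> {} \<and> U \<subseteq> U0 \<and> openin X V \<and> y \<in> V \<and> (\<forall>t\<in>U. \<forall>v\<in>V. \<Phi> t v < d)"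
    if "openin T U0" "U0 \<noteq> {}" "y \<in> topspace X" "\<And>t. t \<in> U0 \<Longrightarrow> \<Phi> t y < c" "c < d" for U0 y c d
    by (rule quasicontinuous_locally_less[OF fT fX c1 c2 _ that])
      (use qc[where D = "{_<..}"] in auto)
  \<comment> \<open>The same lemma with the factors exchanged and \<open>\<Phi>\<close>
    negated.\<close>
  have lower: "\<exists>V U. openin X V \<and> V \<noteq> {} \<and> V \<subseteq> V0 \<and> openin T U \<and> t \<in> U \<and> (\<forall>v\<in>V. \<forall>t\<in>U. - \<Phi> t v < - d)"
    if "openin X V0" "V0 \<noteq> {}" "t \<in> topspace T" "\<And>v. v \<in> V0 \<Longrightarrow> c < \<Phi> t v" "d < c" for V0 t c d
  proof (rule quasicontinuous_locally_less[OF fX fT, where c = "- c"])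
    fix U V x y k assume h: "openin X U" "openin T V" "x \<in> U" "y \<in> V" "k < - \<Phi> y x"
    then have "\<Phi> y x \<in> {..<- k}" by auto
    from qc[OF h(2,1,4,3) this] show "\<exists>U' V'. openin X U' \<and> openin T V' \<and> U' \<noteq> {} \<and> V' \<noteq> {} \<and> U' \<subseteq> U \<and> V' \<subseteq> V \<and>
        (\<forall>u\<in>U'. \<forall>v\<in>V'. k < - \<Phi> v u)"
      by (simp add: less_minus_iff) blast
  qed (use that c1 c2 in \<open>auto intro: continuous_map_minus\<close>)
  \<comment> \<open>\<open>f\<close> is 0 at \<open>x0\<close> and 1 off \<open>N\<close>. The
    levels in between are spent as follows: \<open>upper\<close> weakens 1/5 to 2/5,
    \<open>lower\<close> weakens 4/5 to 3/5, and the gap from 2/5 to 3/5 remains for the double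
    sequence.\<close>
  define U0 where "U0 = {t \<in> topspace T. \<Phi> t x0 < 1/5}"
  have U0: "openin T U0" "?e \<in> U0"
    unfolding U0_def using e unit[OF x0] f(2) by (intro openin_less c1 x0, simp add: \<Phi>_def)
  \<comment> \<open>An arbitrary neighbourhood of \<open>x0\<close> would not do for
    \<open>W\<close>: it must absorb \<open>\<pi> (s, x)\<close> for all \<open>(s, x)\<close> near
    \<open>(1, x0)\<close>, so that it still contains points where \<open>f\<close> is 1.\<close>
  define P where "P U W \<longleftrightarrow> openin T U \<and> ?e \<in> U \<and> U \<subseteq> U0 \<and> openin X W \<and>
      (\<exists>A B. openin T A \<and> ?e \<in> A \<and> openin X B \<and> x0 \<in> B \<and> (\<forall>s\<in>A. \<forall>x\<in>B. \<pi> (s, x) \<in> W))" for U W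
  show False
  proof (rule no_refinement_strategy[OF fT fX c1 c2, of P U0 "topspace X" "3/5" "2/5"])
    have "\<exists>A B. openin T A \<and> ?e \<in> A \<and> openin X B \<and> x0 \<in> B \<and> (\<forall>s\<in>A. \<forall>x\<in>B. \<pi> (s, x) \<in> topspace X)"
      using e x0 ran
      by (intro exI[of _ "topspace T"] exI[of _ "topspace X"]) auto
    then show "P U0 (topspace X)" using U0 by (simp add: P_def)
    show "openin T U" if "P U W" for U W using that by (simp add: P_def)
    fix U W assume PUW: "P U W"
    then obtain A B where AB: "openin T A" "?e \<in> A" "openin X B" "x0 \<in> B" "\<And>s x. s \<in> A \<Longrightarrow> x \<in> B \<Longrightarrow> \<pi> (s, x) \<in> W"
      and U: "openin T U" "?e \<in> U" "U \<subseteq> U0" and W: "openin X W"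
      unfolding P_def by blast
    define V0 where "V0 = W \<inter> {y \<in> topspace X. 4/5 < f y}"
    have "openin X V0" unfolding V0_def by (intro openin_Int W openin_greater fc)
    moreover obtain s x where "s \<in> A" "x \<in> B" "f (\<pi> (s, x)) = 1" using f1[OF AB(1-4)] by blast
    then have "\<pi> (s, x) \<in> V0" using AB(5) openin_subset[OF W] by (auto simp: V0_def)
    then have "V0 \<noteq> {}" by blast
    moreover have "4/5 < \<Phi> ?e v" if "v \<in> V0" for v
      using that unit by (auto simp: V0_def \<Phi>_def)
    ultimately have "\<exists>V U. openin X V \<and> V \<noteq> {} \<and> V \<subseteq> V0 \<and> openin T U \<and> ?e \<in> U \<and>
        (\<forall>v\<in>V. \<forall>t\<in>U. - \<Phi> t v < - (3/5))"
      by (rule lower[OF _ _ e]) auto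
    then obtain V U1 where V: "openin X V" "V \<noteq> {}" "V \<subseteq> V0" and U1: "openin T U1" "?e \<in> U1"
      and big: "\<And>v t. v \<in> V \<Longrightarrow> t \<in> U1 \<Longrightarrow> 3/5 \<le> \<Phi> t v"
      by (metis less_imp_le neg_less_iff_less)
    define U' where "U' = U \<inter> U1"
    have U': "openin T U'" "?e \<in> U'" "U' \<subseteq> U" using U U1 by (auto simp: U'_def)
    have "\<Phi> t x0 < 1/5" if "t \<in> U'" for t
      using that U'(3) U(3) by (auto simp: U0_def)
    \<comment> \<open>\<open>T1\<close> may miss the identity, whereas \<open>B1\<close> is a
      genuine neighbourhood of \<open>x0\<close>.\<close>
    then have "\<exists>T1 B1. openin T T1 \<and> T1 \<noteq> {} \<and> T1 \<subseteq> U' \<and> openin X B1 \<and> x0 \<in> B1 \<and>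
        (\<forall>t\<in>T1. \<forall>v\<in>B1. \<Phi> t v < 2/5)"
      using U' by (intro upper[OF _ _ x0, where c = "1/5"]) auto
    then obtain T1 B1 where T1: "openin T T1" "T1 \<noteq> {}" "T1 \<subseteq> U'" and B1: "openin X B1" "x0 \<in> B1"
      and small: "\<And>t v. t \<in> T1 \<Longrightarrow> v \<in> B1 \<Longrightarrow> \<Phi> t v < 2/5"
      by metis
    obtain t where t: "t \<in> T1" using T1 by blast
    then have tT: "t \<in> topspace T" using openin_subset[OF T1(1)] by blast
    \<comment> \<open>Left multiplication by \<open>t\<close> sends the identity to
      \<open>t\<close>, which lies in \<open>T1\<close>; its continuity makes \<open>A'\<close> a
      neighbourhood of the identity.\<close>
    define A' where "A' = A \<inter> {s \<in> topspace T. t \<otimes>\<^bsub>S\<^esub> s \<in> T1}"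
    define W' where "W' = W \<inter> {y \<in> topspace X. \<Phi> t y < 2/5}"
    have "t \<otimes>\<^bsub>S\<^esub> ?e = t" using mon tT TS monoid.r_one by metis
    then have A': "openin T A'" "?e \<in> A'"
      using AB e t openin_continuous_map_preimage[OF tr[OF tT] T1(1)] by (auto simp: A'_def)
    have "\<pi> (s, x) \<in> W'" if "s \<in> A'" "x \<in> B \<inter> B1" for s x
    proof -
      have x: "x \<in> topspace X" using that openin_subset[OF B1(1)] by blast
      have s: "s \<in> topspace T" "s \<in> A" "t \<otimes>\<^bsub>S\<^esub> s \<in> T1" using that by (auto simp: A'_def)
      \<comment> \<open>The action law moves \<open>s\<close> into the first argument, where
        smallness on \<open>T1 \<times> B1\<close> applies; hence \<open>W'\<close> again absorbs
        nearby \<open>\<pi> (s, x)\<close>.\<close>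
      have "\<Phi> t (\<pi> (s, x)) = \<Phi> (t \<otimes>\<^bsub>S\<^esub> s) x" using act[OF tT s(1) x] by (simp add: \<Phi>_def)
      then show ?thesis using small[OF s(3), of x] that s x AB(5) ran by (simp add: W'_def)
    qed
    then have "\<exists>A B. openin T A \<and> ?e \<in> A \<and> openin X B \<and> x0 \<in> B \<and> (\<forall>s\<in>A. \<forall>x\<in>B. \<pi> (s, x) \<in> W')"
      using A' AB B1 by (intro exI[of _ A'] exI[of _ "B \<inter> B1"]) auto
    moreover have "openin X W'" unfolding W'_def by (intro openin_Int W openin_less c2 tT)
    ultimately have "P U' W'" using U' U by (auto simp: P_def)
    then show "\<exists>U' W' V t. P U' W' \<and> U' \<subseteq> U \<and> W' \<subseteq> W \<and> V \<subseteq> W \<and> openin X V \<and> V \<noteq> {} \<and>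
        (\<forall>x\<in>U'. \<forall>y\<in>V. 3/5 \<le> \<Phi> x y) \<and> t \<in> U' \<and> (\<forall>y\<in>W'. \<Phi> t y \<le> 2/5)"
    proof (intro exI conjI ballI)
      show "U' \<subseteq> U" "W' \<subseteq> W" "V \<subseteq> W" "t \<in> U'"
        using U' V(3) t T1(3) by (auto simp: W'_def V0_def)
      show "3/5 \<le> \<Phi> u v" if "u \<in> U'" "v \<in> V" for u v
        using big that by (simp add: U'_def)
      show "\<Phi> t y \<le> 2/5" if "y \<in> W'" for y
        using that by (simp add: W'_def)
    qed (use V in simp_all)
  qed auto
qed

end
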